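(* For real numbers $\alpha,\beta>1$ and $y>0$, $$\frac{y^{\alpha-1}\zeta_E\left(1-\alpha,\frac{x}{y}\right)}{\Gamma(\alpha)}\ast\frac{y^{\beta-1}\zeta_E\left(1-\beta,\frac{x}{y}\right)}{\Gamma(\beta)}=\frac{y^{\alpha+\beta-1}\zeta_E\left(1-\alpha-\beta,\frac{x}{y}\right)}{\Gamma(\alpha+\beta)}.$$
   Context: The alternating Hurwitz zeta function is $\zeta_E(s,x)=\sum_{n=0}^\infty\frac{(-1)^n}{(n+x)^s}$ for $\mathrm{Re}(s)>0$, analytically continued in $s$ to the whole complex plane; it satisfies $\zeta_E(s,x+1)+\zeta_E(s,x)=x^{-s}$. $\Gamma$ is Euler's Gamma function. For functions $g(x,y),h(x,y)$ ($x\in\mathbb{R}$, $y>0$) the operation $\ast$ is defined by $g\ast h(x,y)=\int_0^x g(t,y)h(x-t,y)\,dt-\int_x^y g(t,y)h(x+y-t,y)\,dt$. *)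

theory Defs
  imports "HOL-Complex_Analysis.Complex_Analysis"
begin

(* The function of s is the unique entire function that agrees with the alternating series on
   Re s > 0.  The second argument ranges over all of the reals, with principal-branch powers
   (negative bases included).  If x = -k for a natural number k, the undefined term n = k of the
   series is 0 by the HOL conventions 0 powr z = 0 and a / 0 = 0; so for Re s < 0 the value is the
   one that agrees with (n + x) powr (-s) = 0 at n = k, and
   zeta_E s (x + 1) + zeta_E s x = x powr (-s) persists there. *)
definition alt_hurwitz_zeta :: "complex \<Rightarrow> real \<Rightarrow> complex" where
  "alt_hurwitz_zeta s x =
    (THE F. F holomorphic_on UNIV \<and>
       (\<forall>z. Re z > 0 \<longrightarrow>
          (\<lambda>n. (-1) ^ n / (of_nat n + of_real x :: complex) powr z) sums F z)) s"

(* Interval integrals are oriented: the integral from a to b is minus the integral from b to a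
   when b < a, which matters for x < 0 and for x > y. *)
definition alt_conv ::
  "(real \<Rightarrow> real \<Rightarrow> complex) \<Rightarrow> (real \<Rightarrow> real \<Rightarrow> complex) \<Rightarrow> real \<Rightarrow> real \<Rightarrow> complex" where
  "alt_conv g h x y =
     (LBINT t=ereal 0..ereal x. g t y * h (x - t) y)
   - (LBINT t=ereal x..ereal y. g t y * h (x + y - t) y)"

end

(* Scaling reduces the claim to y = 1.  For eps > 0 replace x^(alpha-1) by the damped power
   exp(-eps x) x^(alpha-1) and zeta_E(1-alpha, x) by the absolutely convergent sum
   Z_alpha(x) = sum_n (-1)^n exp(-eps (n+x)) (n+x)^(alpha-1), so that Z_alpha(x+1) + Z_alpha(x) is the
   damped power.  Splitting and shifting the integrals shows that the convolution
   C = Z_alpha * Z_beta has C(x+1) + C(x) equal to the ordinary convolution of the damped powers over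
   [0,x], which is B(alpha,beta) times the damped power of exponent alpha+beta-1.  Hence
   D = C - B(alpha,beta) Z_{alpha+beta} satisfies D(x+1) = -D(x); as D decays at infinity, D = 0.
   Euler's transformation of alternating series makes Z jointly continuous in (eps, x) down to
   eps = 0, where it takes the value of the analytically continued zeta function; so eps -> 0 gives
   the theorem. *)
theory Submission
  imports Defs
begin

section \<open>Oriented integrals of continuous functions\<close>

text \<open>An antiderivative on the whole line turns every oriented integral into a difference of
  two values, so splitting and substitution need no case distinction on the order of the
  endpoints.\<close>

lemma interval_integral_eq_antiderivative:
  fixes f :: "real \<Rightarrow> complex"
  assumes "continuous_on UNIV f"
  obtains \<Phi> where "\<And>t. (\<Phi> has_vector_derivative f t) (at t)"
    and "\<And>a b. (LBINT t=ereal a..ereal b. f t) = \<Phi> b - \<Phi> a"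
proof -
  have "\<exists>\<Phi>. \<forall>t::real. -\<infinity> < ereal t \<longrightarrow> ereal t < \<infinity> \<longrightarrow> (\<Phi> has_vector_derivative f t) (at t)"
    using assms by (intro einterval_antiderivative) (auto simp: continuous_on_eq_continuous_at)
  then obtain \<Phi> where \<Phi>: "\<And>t. (\<Phi> has_vector_derivative f t) (at t)"
    by auto
  moreover have "(LBINT t=ereal a..ereal b. f t) = \<Phi> b - \<Phi> a" for a b
    using assms \<Phi>
    by (intro interval_integral_FTC_finite)
       (auto intro: continuous_on_subset has_vector_derivative_at_within)
  ultimately show thesis by (rule that)
qed

text \<open>Keeping the factor \<open>c\<close> on the left lets the rule cover every real
  \<open>c\<close>; negative values occur when an integral from 0 to a negative \<open>x\<close> is
  rescaled to the unit interval.\<close>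

lemma interval_integral_affine:
  fixes f :: "real \<Rightarrow> complex" and a b c d :: real
  assumes "continuous_on UNIV f"
  shows "c * (LBINT t=ereal a..ereal b. f (c * t + d)) = (LBINT t=ereal (c * a + d)..ereal (c * b + d). f t)"
proof -
  obtain \<Phi> where \<Phi>: "\<And>t. (\<Phi> has_vector_derivative f t) (at t)"
      and int: "\<And>a b. (LBINT t=ereal a..ereal b. f t) = \<Phi> b - \<Phi> a"
    by (rule interval_integral_eq_antiderivative[OF assms]) blast
  have "((\<lambda>t. \<Phi> (c * t + d)) has_vector_derivative c *\<^sub>R f (c * t + d)) (at t)" for t
  proof -
    have "((\<lambda>t. c * t + d) has_vector_derivative c) (at t)"
      by (auto intro!: derivative_eq_intros simp flip: has_real_derivative_iff_has_vector_derivative)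
    from vector_diff_chain_at[OF this \<Phi>] show ?thesis
      by (simp add: o_def)
  qed
  moreover have cont: "continuous_on UNIV (\<lambda>t. f (c * t + d))"
    by (intro continuous_on_compose2[OF assms] continuous_intros) auto
  ultimately have "(LBINT t=ereal a..ereal b. c *\<^sub>R f (c * t + d)) = \<Phi> (c * b + d) - \<Phi> (c * a + d)"
    by (intro interval_integral_FTC_finite)
       (auto intro!: continuous_intros intro: continuous_on_subset has_vector_derivative_at_within)
  then show ?thesis
    using int by (simp add: scaleR_conv_of_real)
qed

lemma interval_integrable_continuous_UNIV:
  fixes f :: "real \<Rightarrow> complex"
  assumes "continuous_on UNIV f"
  shows "interval_lebesgue_integrable lborel (ereal a) (ereal b) f"
proof (cases "a \<le> b")
  case True
  with assms show ?thesis
    by (intro interval_integrable_continuous_on) (auto intro: continuous_on_subset)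
next
  case False
  with assms show ?thesis
    by (subst interval_integrable_endpoints_reverse, intro interval_integrable_continuous_on)
       (auto intro: continuous_on_subset)
qed

lemma interval_integral_combine_continuous:
  fixes f :: "real \<Rightarrow> complex"
  assumes "continuous_on UNIV f"
  shows "(LBINT t=ereal a..ereal b. f t) + (LBINT t=ereal b..ereal c. f t) = (LBINT t=ereal a..ereal c. f t)"
proof -
  obtain \<Phi> where "\<And>a b. (LBINT t=ereal a..ereal b. f t) = \<Phi> b - \<Phi> a"
    by (rule interval_integral_eq_antiderivative[OF assms]) blast
  then show ?thesis by simp
qed

lemma interval_integral_eq_integral_continuous:
  fixes f :: "real \<Rightarrow> complex" and a b :: real
  assumes "continuous_on {a..b} f" and "a \<le> b"
  shows "(LBINT t=ereal a..ereal b. f t) = integral {a..b} f"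
  using assms by (intro interval_integral_eq_integral borel_integrable_atLeastAtMost')

text \<open>Serves to let the damping parameter tend to 0 under the integral sign, with the
  endpoints in either order.\<close>

lemma continuous_on_interval_integral_param:
  fixes f :: "'a::topological_space \<Rightarrow> real \<Rightarrow> complex" and a b :: real
  assumes "continuous_on (U \<times> UNIV) (\<lambda>(u, t). f u t)"
  shows "continuous_on U (\<lambda>u. LBINT t=ereal a..ereal b. f u t)"
proof -
  have section_cont: "continuous_on A (f u)" if "u \<in> U" for u A
  proof -
    have "continuous_on A (\<lambda>t. (\<lambda>(u, t). f u t) (u, t))"
      using that by (intro continuous_on_compose2[OF assms] continuous_intros) auto
    then show ?thesis by simp
  qed
  have *: "continuous_on U (\<lambda>u. LBINT t=ereal a..ereal b. f u t)" if "a \<le> b" for a b :: real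
  proof -
    have "continuous_on U (\<lambda>u. integral (cbox a b) (f u))"
      by (intro integral_continuous_on_param continuous_on_subset[OF assms]) auto
    then show ?thesis
      using that by (subst continuous_on_cong[OF refl, where g = "\<lambda>u. integral (cbox a b) (f u)"])
         (auto simp: interval_integral_eq_integral_continuous section_cont)
  qed
  show ?thesis
  proof (cases "a \<le> b")
    case False
    then have "continuous_on U (\<lambda>u. - (LBINT t=ereal b..ereal a. f u t))"
      by (intro continuous_intros *) auto
    then show ?thesis by (subst interval_integral_endpoints_reverse)
  qed (use * in blast)
qed

lemma norm_interval_integral_le:
  fixes f :: "real \<Rightarrow> complex" and a b :: real
  assumes "continuous_on {a..b} f" and "a \<le> b" and "\<And>t. t \<in> {a..b} \<Longrightarrow> norm (f t) \<le> B"
  shows "norm (LBINT t=ereal a..ereal b. f t) \<le> B * (b - a)"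
  unfolding interval_integral_eq_integral_continuous[OF assms(1,2)]
  using assms by (intro integral_bound) auto

section \<open>Antiperiodic convolution\<close>

text \<open>The operation \<open>alt_conv\<close> at \<open>y = 1\<close>, for functions of one
  variable. If \<open>b (x + 1) = - b x\<close> for all \<open>x\<close>, it reduces to the integral
  of \<open>a t * b (x - t)\<close> over the unit interval, hence the name.\<close>

definition antiperiodic_conv :: "(real \<Rightarrow> complex) \<Rightarrow> (real \<Rightarrow> complex) \<Rightarrow> real \<Rightarrow> complex" where
  "antiperiodic_conv a b x =
     (LBINT t=ereal 0..ereal x. a t * b (x - t)) - (LBINT t=ereal x..ereal 1. a t * b (x + 1 - t))"

text \<open>Regrouping the four integrals puts \<open>b (c + 1 - t) + b (c - t)\<close>, that is
  \<open>l (c - t)\<close>, under an integral from 0 to \<open>x\<close> with \<open>c = x\<close>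
  and one from 1 to \<open>x + 1\<close> with \<open>c = x + 1\<close>. Shifting the latter by 1
  pairs \<open>a (t + 1)\<close> with \<open>a t\<close> and gives \<open>k t\<close>.\<close>

lemma antiperiodic_conv_add:
  fixes a b k l :: "real \<Rightarrow> complex"
  assumes a: "continuous_on UNIV a" "\<And>x. a (x + 1) + a x = k x"
    and b: "continuous_on UNIV b" "\<And>x. b (x + 1) + b x = l x"
  shows "antiperiodic_conv a b (x + 1) + antiperiodic_conv a b x
           = (LBINT t=ereal 0..ereal x. k t * l (x - t))"
proof -
  define I where "I u v c = (LBINT t=ereal u..ereal v. a t * b (c - t))" for u v c
  have cont: "continuous_on UNIV (\<lambda>t. a t * b (c - t))" for c
    by (intro continuous_intros a continuous_on_compose2[OF b(1)]) auto
  note int = interval_integrable_continuous_UNIV[OF cont]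
  have comb: "I u v c + I v w c = I u w c" for u v w c
    unfolding I_def by (rule interval_integral_combine_continuous[OF cont])
  have l: "continuous_on UNIV l"
  proof -
    have "continuous_on UNIV (\<lambda>x. b (x + 1) + b x)"
      by (intro continuous_intros b continuous_on_compose2[OF b(1)]) auto
    then show ?thesis by (simp add: b(2))
  qed
  have add: "I u v (c + 1) + I u v c = (LBINT t=ereal u..ereal v. a t * l (c - t))" for u v c
  proof -
    have "(\<lambda>t. a t * l (c - t)) = (\<lambda>t. a t * b (c + 1 - t) + a t * b (c - t))"
      by (simp add: algebra_simps flip: b(2))
    then show ?thesis
      unfolding I_def using interval_lebesgue_integral_add(2)[OF int int] by metis
  qed
  have contl: "continuous_on UNIV (\<lambda>t. a t * l (c - t))" for c
    by (intro continuous_intros a continuous_on_compose2[OF l]) auto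
  have "antiperiodic_conv a b (x + 1) + antiperiodic_conv a b x
      = (I 0 (x + 1) (x + 1) - I (x + 1) 1 (x + 1 + 1)) + (I 0 x x - I x 1 (x + 1))"
    by (simp add: antiperiodic_conv_def I_def)
  \<comment> \<open>The part from \<open>x\<close> to 1 cancels among the integrals with third
    argument \<open>x + 1\<close>. The instance of \<open>comb\<close> with endpoint 1 repeated
    makes the integral from 1 to 1 vanish, which reverses the one from \<open>x + 1\<close> to
    1.\<close>
  also have "\<dots> = (I 0 x (x + 1) + I 0 x x) + (I 1 (x + 1) (x + 1 + 1) + I 1 (x + 1) (x + 1))"
    using comb[of 0 x "x + 1" "x + 1"] comb[of x 1 "x + 1" "x + 1"]
      comb[of 1 "x + 1" "x + 1 + 1" 1] comb[of 1 1 "x + 1 + 1" 1]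
    by (simp add: algebra_simps)
  also have "\<dots> = (LBINT t=ereal 0..ereal x. a t * l (x - t))
                + (LBINT t=ereal 1..ereal (x + 1). a t * l (x + 1 - t))"
    by (simp only: add)
  also have "(LBINT t=ereal 1..ereal (x + 1). a t * l (x + 1 - t))
           = (LBINT t=ereal 0..ereal x. a (t + 1) * l (x - t))"
    using interval_integral_affine[OF contl[of "x + 1"], where c = 1 and d = 1 and a = 0 and b = x] by (simp add: algebra_simps)
  also have "(LBINT t=ereal 0..ereal x. a t * l (x - t)) + \<dots>
           = (LBINT t=ereal 0..ereal x. a t * l (x - t) + a (t + 1) * l (x - t))"
    by (intro interval_lebesgue_integral_add(2)[symmetric] interval_integrable_continuous_UNIV
          continuous_intros a continuous_on_compose2[OF l] continuous_on_compose2[OF a(1)]) auto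
  also have "\<dots> = (LBINT t=ereal 0..ereal x. k t * l (x - t))"
    by (simp add: algebra_simps flip: a(2))
  finally show ?thesis .
qed

text \<open>The norm of \<open>D\<close> has period 1, so its value at \<open>x\<close> recurs along
  \<open>x + real n\<close> and must equal the limit 0.\<close>

lemma antiperiodic_tendsto_0_imp_0:
  fixes D :: "real \<Rightarrow> complex"
  assumes "\<And>x. D (x + 1) = - D x" and "(D \<longlongrightarrow> 0) at_top"
  shows "D x = 0"
proof -
  have shift: "norm (D (x + real n)) = norm (D x)" for n
  proof (induction n)
    case (Suc n)
    then show ?case using assms(1)[of "x + real n"] by (simp add: algebra_simps)
  qed simp
  have "filterlim (\<lambda>n. x + real n) at_top sequentially"
    by real_asymp
  from filterlim_compose[OF assms(2) this] have "(\<lambda>n. norm (D (x + real n))) \<longlonglongrightarrow> 0"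
    by (rule tendsto_norm_zero)
  then show ?thesis unfolding shift by (simp add: LIMSEQ_const_iff)
qed

text \<open>After reversing the second integral both integrands are at most \<open>K * L * exp (- c * x)\<close>.\<close>
lemma antiperiodic_conv_tendsto_0:
  fixes a b :: "real \<Rightarrow> complex"
  assumes "continuous_on UNIV a" "continuous_on UNIV b" "c > 0"
    and a: "\<And>t. t \<ge> 0 \<Longrightarrow> norm (a t) \<le> K * exp (- c * t)"
    and b: "\<And>t. t \<ge> 0 \<Longrightarrow> norm (b t) \<le> L * exp (- c * t)"
  shows "(antiperiodic_conv a b \<longlongrightarrow> 0) at_top"
proof (rule Lim_null_comparison)
  have cont: "continuous_on A (\<lambda>t. a t * b (d - t))" for A d
    by (rule continuous_on_subset[of UNIV])
       (auto intro!: continuous_intros assms continuous_on_compose2[OF assms(2)])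
  have KL: "0 \<le> K * L"
    using order_trans[OF norm_ge_zero a[of 0]] order_trans[OF norm_ge_zero b[of 0]] by simp
  have prod: "norm (a t * b (d - t)) \<le> K * L * exp (- c * x)" if "0 \<le> t" "t \<le> d" "x \<le> d" for t d x
  proof -
    have "norm (a t * b (d - t)) \<le> (K * exp (- c * t)) * (L * exp (- c * (d - t)))"
      unfolding norm_mult using that by (intro mult_mono a b order_trans[OF norm_ge_zero a]) auto
    also have "\<dots> = K * L * exp (- c * d)"
      by (simp add: algebra_simps flip: exp_add)
    also have "\<dots> \<le> K * L * exp (- c * x)"
      using that \<open>c > 0\<close> KL by (intro mult_left_mono) auto
    finally show ?thesis .
  qed
  have "norm (antiperiodic_conv a b x) \<le> K * L * exp (- c * x) * (2 * x)" if "x \<ge> 1" for x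
  proof -
    have "norm (LBINT t=ereal 0..ereal x. a t * b (x - t)) \<le> K * L * exp (- c * x) * (x - 0)"
      using that by (intro norm_interval_integral_le cont prod) auto
    moreover have "norm (LBINT t=ereal 1..ereal x. a t * b (x + 1 - t)) \<le> K * L * exp (- c * x) * (x - 1)"
      using that by (intro norm_interval_integral_le cont prod) auto
    moreover have "antiperiodic_conv a b x = (LBINT t=ereal 0..ereal x. a t * b (x - t))
        + (LBINT t=ereal 1..ereal x. a t * b (x + 1 - t))"
      unfolding antiperiodic_conv_def by (subst (2) interval_integral_endpoints_reverse) simp
    ultimately have "norm (antiperiodic_conv a b x)
        \<le> K * L * exp (- c * x) * x + K * L * exp (- c * x) * (x - 1)"
      by (metis (no_types, lifting) norm_triangle_mono diff_zero)
    also have "\<dots> \<le> K * L * exp (- c * x) * (2 * x)"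
      using mult_nonneg_nonneg[OF KL, of "exp (- c * x)"] by (simp add: algebra_simps)
    finally show ?thesis .
  qed
  then show "\<forall>\<^sub>F x in at_top. norm (antiperiodic_conv a b x) \<le> K * L * exp (- c * x) * (2 * x)"
    using eventually_ge_at_top[of 1] by (rule eventually_mono[rotated])
  show "((\<lambda>x. K * L * exp (- c * x) * (2 * x)) \<longlongrightarrow> 0) at_top"
    using \<open>c > 0\<close> by real_asymp
qed

section \<open>Euler's transformation of alternating series\<close>

text \<open>The negative of the forward difference. With this sign a convergent alternating sum of
  \<open>f\<close> is half the sum of \<open>f x\<close> and the alternating sum of
  \<open>\<nabla> f\<close>.\<close>

definition backward_diff :: "(real \<Rightarrow> complex) \<Rightarrow> real \<Rightarrow> complex" (\<open>\<nabla>\<close>) where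
  "\<nabla> f x = f x - f (x + 1)"

lemma iterated_diff_Suc: "(\<nabla> ^^ Suc m) f x = (\<nabla> ^^ m) f x - (\<nabla> ^^ m) f (x + 1)"
  unfolding funpow.simps o_def by (rule backward_diff_def)

lemma iterated_diff_Suc': "(\<nabla> ^^ m) (\<nabla> f) = (\<nabla> ^^ Suc m) f"
  by (simp add: funpow_swap1)

text \<open>Unrolled: the sum over \<open>j < m\<close> of
  \<open>(\<nabla> ^^ j) f x / 2 ^ (j + 1)\<close>, plus \<open>1 / 2 ^ m\<close> times the
  alternating series of \<open>(\<nabla> ^^ m) f\<close>. Differencing a power improves its decay,
  so for large \<open>m\<close> that series converges absolutely even if the original one
  diverges.\<close>

fun euler_sum :: "nat \<Rightarrow> (real \<Rightarrow> complex) \<Rightarrow> real \<Rightarrow> complex" where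
  "euler_sum 0 f x = (\<Sum>n. (-1) ^ n * f (x + real n))"
| "euler_sum (Suc m) f x = (f x + euler_sum m (\<nabla> f) x) / 2"

text \<open>Summation by parts: twice a partial sum is \<open>f x\<close> plus the partial sum of
  differences, up to a boundary term \<open>(-1) ^ N * f (x + real N)\<close> that tends to
  0.\<close>

lemma alternating_sums_via_diff:
  assumes "(\<lambda>n. f (x + real n)) \<longlonglongrightarrow> 0"
    and "(\<lambda>n. (-1) ^ n * \<nabla> f (x + real n)) sums T"
  shows "(\<lambda>n. (-1) ^ n * f (x + real n)) sums ((f x + T) / 2)"
proof -
  have partial: "(\<Sum>n<N. (-1) ^ n * f (x + real n))
      = (f x + (\<Sum>n<N. (-1) ^ n * \<nabla> f (x + real n)) - (-1) ^ N * f (x + real N)) / 2" for N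
    by (induction N) (simp_all add: backward_diff_def algebra_simps)
  have "(\<lambda>N. norm ((-1) ^ N * f (x + real N))) \<longlonglongrightarrow> 0"
    using tendsto_norm_zero[OF assms(1)] by (simp add: norm_mult norm_power)
  then have "(\<lambda>N. (-1) ^ N * f (x + real N)) \<longlonglongrightarrow> 0"
    by (rule tendsto_norm_zero_cancel)
  with assms(2) have "(\<lambda>N. (f x + (\<Sum>n<N. (-1) ^ n * \<nabla> f (x + real n)) - (-1) ^ N * f (x + real N)) / 2)
      \<longlonglongrightarrow> (f x + T - 0) / 2"
    unfolding sums_def by (intro tendsto_intros) auto
  then show ?thesis unfolding sums_def partial by simp
qed

text \<open>Absolute summability is asked of the last difference alone, so conditionally convergent
  series are included.\<close>

lemma alternating_sums_euler_sum:
  assumes "(\<lambda>n. f (x + real n)) \<longlonglongrightarrow> 0"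
    and "summable (\<lambda>n. norm ((\<nabla> ^^ m) f (x + real n)))"
  shows "(\<lambda>n. (-1) ^ n * f (x + real n)) sums euler_sum m f x"
  using assms
proof (induction m arbitrary: f)
  case 0
  then have "summable (\<lambda>n. norm ((-1) ^ n * f (x + real n)))"
    by (simp add: norm_mult norm_power)
  then show ?case by (simp add: summable_norm_cancel summable_sums)
next
  case (Suc m)
  have "(\<lambda>n. f (x + real n) - f (x + real (Suc n))) \<longlonglongrightarrow> 0 - 0"
    using Suc.prems(1) by (intro tendsto_diff LIMSEQ_Suc)
  then have "(\<lambda>n. \<nabla> f (x + real n)) \<longlonglongrightarrow> 0"
    by (simp add: backward_diff_def add_ac)
  moreover have "summable (\<lambda>n. norm ((\<nabla> ^^ m) (\<nabla> f) (x + real n)))"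
    using Suc.prems(2) by (simp add: funpow_swap1)
  ultimately show ?case
    using Suc.IH Suc.prems(1) alternating_sums_via_diff by simp
qed

text \<open>The induction passes from \<open>f\<close> to \<open>\<nabla> f\<close> and compares
  series only in the base case, so the value is unchanged even where the alternating series of
  \<open>f\<close> diverges.\<close>

lemma euler_sum_Suc:
  assumes "summable (\<lambda>n. norm ((\<nabla> ^^ m) f (x + real n)))"
    and "summable (\<lambda>n. norm ((\<nabla> ^^ Suc m) f (x + real n)))"
  shows "euler_sum (Suc m) f x = euler_sum m f x"
  using assms
proof (induction m arbitrary: f)
  case 0
  then have "(\<lambda>n. f (x + real n)) \<longlonglongrightarrow> 0"
    by (auto intro: tendsto_norm_zero_cancel dest: summable_LIMSEQ_zero)
  from alternating_sums_euler_sum[OF this] 0 show ?case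
    using sums_unique by (metis euler_sum.simps(1))
next
  case (Suc m)
  have "summable (\<lambda>n. norm ((\<nabla> ^^ m) (\<nabla> f) (x + real n)))"
       "summable (\<lambda>n. norm ((\<nabla> ^^ Suc m) (\<nabla> f) (x + real n)))"
    using Suc.prems by (simp_all add: funpow_swap1)
  from Suc.IH[OF this] show ?case by simp
qed

section \<open>Bounds on iterated differences of damped powers\<close>

text \<open>A repeated mean value inequality: a difference over a unit step is at most a bound on
  the derivative. \<open>F j\<close> stands for the \<open>j\<close>-th derivative of
  \<open>F 0\<close> to the right of \<open>t\<close>.\<close>

lemma norm_iterated_diff_le:
  fixes F :: "nat \<Rightarrow> real \<Rightarrow> complex"
  assumes deriv: "\<And>j u. u \<ge> t \<Longrightarrow> (F j has_vector_derivative F (Suc j) u) (at u)"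
    and bound: "\<And>u. u \<ge> t \<Longrightarrow> norm (F m u) \<le> B"
  shows "norm ((\<nabla> ^^ m) (F 0) t) \<le> B"
proof -
  have deriv': "((\<nabla> ^^ i) (F j) has_vector_derivative (\<nabla> ^^ i) (F (Suc j)) u) (at u)"
    if "u \<ge> t" for i j u
    using that
  proof (induction i arbitrary: u)
    case (Suc i)
    have "((\<lambda>u. (\<nabla> ^^ i) (F j) (u + 1)) has_vector_derivative (\<nabla> ^^ i) (F (Suc j)) (u + 1)) (at u)"
    proof -
      have "((\<lambda>u. u + 1) has_vector_derivative 1) (at u)"
        by (auto intro!: derivative_eq_intros simp flip: has_real_derivative_iff_has_vector_derivative)
      from vector_diff_chain_at[OF this Suc.IH] Suc.prems show ?thesis
        by (simp add: o_def)
    qed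
    then have "((\<lambda>u. (\<nabla> ^^ i) (F j) u - (\<nabla> ^^ i) (F j) (u + 1)) has_vector_derivative
        (\<nabla> ^^ i) (F (Suc j)) u - (\<nabla> ^^ i) (F (Suc j)) (u + 1)) (at u)"
      using Suc by (intro has_vector_derivative_diff)
    then show ?case by (simp add: iterated_diff_Suc[abs_def] del: funpow.simps)
  qed (use deriv in auto)
  \<comment> \<open>With \<open>i\<close> differences and \<open>j\<close> derivatives, each
    induction step trades a difference for a derivative, down to the given bound on
    \<open>F m\<close>.\<close>
  have "norm ((\<nabla> ^^ i) (F j) u) \<le> B" if "i + j = m" "u \<ge> t" for i j u
    using that
  proof (induction i arbitrary: j u)
    case (Suc i)
    have "norm ((\<nabla> ^^ i) (F j) (u + 1) - (\<nabla> ^^ i) (F j) u) \<le> B * norm (u + 1 - u)"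
    proof (rule differentiable_bound)
      show "((\<nabla> ^^ i) (F j) has_derivative (\<lambda>h. h *\<^sub>R (\<nabla> ^^ i) (F (Suc j)) v)) (at v within {u..u + 1})"
        if "v \<in> {u..u + 1}" for v
        using deriv'[of v i j] that Suc.prems
        by (auto simp: has_vector_derivative_def intro: has_derivative_at_withinI)
      show "onorm (\<lambda>h. h *\<^sub>R (\<nabla> ^^ i) (F (Suc j)) v) \<le> B" if "v \<in> {u..u + 1}" for v
        using Suc.IH[of "Suc j" v] that Suc.prems
        by (intro onorm_le) (auto simp: mult.commute[of B] intro: mult_left_mono)
    qed auto
    then show ?case by (simp add: iterated_diff_Suc norm_minus_commute del: funpow.simps)
  qed (use bound in auto)
  from this[of m 0 t] show ?thesis by simp
qed

text \<open>Cauchy's estimate on the disc of radius \<open>t / 2\<close> about \<open>t\<close>: as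
  the radius grows with \<open>t\<close>, each derivative gains a factor of order
  \<open>1 / t\<close>, and \<open>m\<close> of them turn growth \<open>t powr p\<close> into decay
  \<open>1 / t\<^sup>2\<close>.\<close>

lemma norm_iterated_diff_holomorphic_le:
  assumes holo: "f holomorphic_on {z. Re z > 0}"
    and bound: "\<And>t z. t \<ge> 1 \<Longrightarrow> norm (of_real t - z) = t / 2 \<Longrightarrow> norm (f z) \<le> C * t powr p"
    and "C \<ge> 0" and "p + 2 \<le> real m" and "t \<ge> 1"
  shows "norm ((\<nabla> ^^ m) (\<lambda>u. f (of_real u)) t) \<le> fact m * 2 ^ m * C / t\<^sup>2"
proof -
  define F where "F j u = (deriv ^^ j) f (complex_of_real u)" for j u
  have op: "open {z. Re z > 0}" by (simp add: open_halfspace_Re_gt)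
  have "norm ((\<nabla> ^^ m) (F 0) t) \<le> fact m * 2 ^ m * C / t\<^sup>2"
  proof (rule norm_iterated_diff_le)
    fix u assume "t \<le> u"
    then have u: "u \<ge> 1" using \<open>t \<ge> 1\<close> by simp
    show "(F j has_vector_derivative F (Suc j) u) (at u)" for j
      unfolding F_def using u
      by (intro has_vector_derivative_real_field has_field_derivative_higher_deriv[OF holo op]) auto
    have sub: "cball (of_real u) (u / 2) \<subseteq> {z. Re z > 0}"
    proof
      fix z :: complex assume "z \<in> cball (of_real u) (u / 2)"
      then show "z \<in> {z. Re z > 0}"
        using complex_Re_le_cmod[of "complex_of_real u - z"] u by (simp add: dist_norm)
    qed
    have "norm ((deriv ^^ m) f (of_real u)) \<le> fact m * (C * u powr p) / (u / 2) ^ m"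
      using u sub bound ball_subset_cball
      by (intro Cauchy_inequality holomorphic_on_subset[OF holo]
          holomorphic_on_imp_continuous_on) fastforce+
    also have "\<dots> = fact m * 2 ^ m * C * (u powr p / u ^ m)"
      using u by (simp add: power_divide)
    also have "u powr p / u ^ m = u powr (p - real m)"
      using u by (simp add: powr_diff powr_realpow)
    also have "\<dots> \<le> u powr (-2)"
      using u assms(4) by (intro powr_mono) auto
    \<comment> \<open>The estimate at \<open>u\<close> is weakened to one at \<open>t\<close>, since
      a single bound is required on the whole half-line from \<open>t\<close>.\<close>
    also have "\<dots> \<le> t powr (-2)"
      using \<open>t \<le> u\<close> \<open>t \<ge> 1\<close> by (intro powr_mono2') auto
    also have "t powr (-2) = 1 / t\<^sup>2"
      using \<open>t \<ge> 1\<close> by (simp add: powr_minus powr_realpow divide_inverse)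
    finally show "norm (F m u) \<le> fact m * 2 ^ m * C / t\<^sup>2"
      using \<open>C \<ge> 0\<close> by (simp add: F_def mult_left_mono)
  qed
  moreover have "F 0 = (\<lambda>u. f (of_real u))"
    by (simp add: F_def fun_eq_iff)
  ultimately show ?thesis by simp
qed

text \<open>The sign of \<open>s\<close> is that of the zeta function: \<open>\<epsilon> = 0\<close>
  gives its summand, and \<open>s = 1 - \<alpha>\<close> the exponent
  \<open>\<alpha> - 1\<close>.\<close>

definition damped_power :: "real \<Rightarrow> complex \<Rightarrow> real \<Rightarrow> complex" where
  "damped_power \<epsilon> s x = of_real (exp (- \<epsilon> * x)) * of_real x powr (- s)"

text \<open>On this circle \<open>Re z > 0\<close>, so the damping factor has norm at most 1 and the
  bound is uniform in \<open>\<epsilon>\<close>. The factor \<open>2 powr \<bar>Re s\<bar>\<close>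
  comes from comparing \<open>norm z\<close> with \<open>t\<close>, the exponential from the
  argument of \<open>z\<close>.\<close>

lemma norm_damped_power_complex_le:
  fixes z s :: complex
  assumes "\<epsilon> \<ge> 0" "t > 0" and z: "norm (of_real t - z) = t / 2"
  shows "norm (exp (- of_real \<epsilon> * z) * z powr (- s))
           \<le> (2 powr \<bar>Re s\<bar> * exp (pi * \<bar>Im s\<bar>)) * t powr (- Re s)"
proof -
  have "Re z \<ge> t / 2"
    using complex_Re_le_cmod[of "of_real t - z"] z by simp
  then have "z \<noteq> 0" "Re z > 0" using \<open>t > 0\<close> by auto
  have lower: "t / 2 \<le> norm z" and upper: "norm z \<le> 2 * t"
    using norm_triangle_ineq2[of "of_real t" z] norm_triangle_ineq2[of z "of_real t"] z \<open>t > 0\<close>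
    by (auto simp: norm_minus_commute)
  have "norm (exp (- of_real \<epsilon> * z)) \<le> 1"
    using \<open>\<epsilon> \<ge> 0\<close> \<open>Re z > 0\<close> by (simp add: norm_exp_eq_Re)
  moreover have "norm (z powr (- s)) \<le> 2 powr \<bar>Re s\<bar> * t powr (- Re s) * exp (pi * \<bar>Im s\<bar>)"
  proof -
    have "norm (z powr (- s)) = norm z powr (- Re s) * exp (Im s * Im (Ln z))"
      using \<open>z \<noteq> 0\<close> by (simp add: powr_def norm_exp_eq_Re flip: exp_add)
    also have "norm z powr (- Re s) \<le> 2 powr \<bar>Re s\<bar> * t powr (- Re s)"
    proof (cases "Re s \<ge> 0")
      case True
      have "norm z powr (- Re s) \<le> (t / 2) powr (- Re s)"
        using True lower \<open>t > 0\<close> by (intro powr_mono2') auto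
      also have "\<dots> = 2 powr \<bar>Re s\<bar> * t powr (- Re s)"
        using True \<open>t > 0\<close> by (simp add: powr_divide powr_minus field_simps)
      finally show ?thesis .
    next
      case False
      have "norm z powr (- Re s) \<le> (2 * t) powr (- Re s)"
        using False upper by (intro powr_mono2) auto
      then show ?thesis using False \<open>t > 0\<close> by (simp add: powr_mult)
    qed
    also have "Im s * Im (Ln z) \<le> pi * \<bar>Im s\<bar>"
    proof -
      have "Im s * Im (Ln z) \<le> \<bar>Im s\<bar> * \<bar>Im (Ln z)\<bar>"
        by (metis abs_ge_self abs_mult)
      also have "\<dots> \<le> \<bar>Im s\<bar> * pi"
        using mpi_less_Im_Ln[OF \<open>z \<noteq> 0\<close>] Im_Ln_le_pi[OF \<open>z \<noteq> 0\<close>] by (intro mult_left_mono) auto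
      finally show ?thesis by (simp add: mult.commute)
    qed
    finally show ?thesis by (simp add: mult_left_mono mult_right_mono)
  qed
  ultimately have "norm (exp (- of_real \<epsilon> * z)) * norm (z powr (- s))
      \<le> 1 * (2 powr \<bar>Re s\<bar> * t powr (- Re s) * exp (pi * \<bar>Im s\<bar>))"
    by (intro mult_mono) auto
  then show ?thesis by (simp add: norm_mult mult_ac)
qed

definition diff_bound :: "nat \<Rightarrow> complex \<Rightarrow> real" where
  "diff_bound m s = fact m * 2 ^ m * (2 powr \<bar>Re s\<bar> * exp (pi * \<bar>Im s\<bar>))"

text \<open>Since \<open>x + real n\<close> is at least \<open>n + 1\<close>, one summable majorant
  serves all \<open>x \<ge> 1\<close> and all \<open>\<epsilon> \<ge> 0\<close>, including
  0.\<close>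

lemma norm_iterated_diff_damped_power_le:
  assumes "\<epsilon> \<ge> 0" "2 - real m \<le> Re s" "x \<ge> 1"
  shows "norm ((\<nabla> ^^ m) (damped_power \<epsilon> s) (x + real n)) \<le> diff_bound m s * (1 / (real (Suc n))\<^sup>2)"
proof -
  define f where "f z = exp (- of_real \<epsilon> * z) * z powr (- s)" for z
  have holo: "f holomorphic_on {z. Re z > 0}"
    unfolding f_def by (intro holomorphic_intros) (auto simp: complex_nonpos_Reals_iff)
  have "norm ((\<nabla> ^^ m) (\<lambda>u. f (of_real u)) (x + real n))
      \<le> fact m * 2 ^ m * (2 powr \<bar>Re s\<bar> * exp (pi * \<bar>Im s\<bar>)) / (x + real n)\<^sup>2"
  proof (rule norm_iterated_diff_holomorphic_le[OF holo])
    show "norm (f z) \<le> (2 powr \<bar>Re s\<bar> * exp (pi * \<bar>Im s\<bar>)) * t powr (- Re s)"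
      if "t \<ge> 1" "norm (of_real t - z) = t / 2" for t z
      unfolding f_def using assms that by (intro norm_damped_power_complex_le) auto
  qed (use assms in auto)
  also have "(\<lambda>u. f (of_real u)) = damped_power \<epsilon> s"
    by (simp add: f_def damped_power_def fun_eq_iff exp_of_real flip: of_real_mult of_real_minus)
  also have "fact m * 2 ^ m * (2 powr \<bar>Re s\<bar> * exp (pi * \<bar>Im s\<bar>)) / (x + real n)\<^sup>2
      \<le> diff_bound m s * (1 / (real (Suc n))\<^sup>2)"
    unfolding diff_bound_def times_divide_eq_right mult_1_right
    using assms by (intro divide_left_mono power_mono) auto
  finally show ?thesis .
qed

lemma summable_diff_bound: "summable (\<lambda>n. B * (1 / (real (Suc n))\<^sup>2))"
  using inverse_power_summable[of 2, where 'a = real]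
  by (intro summable_mult, subst summable_Suc_iff) (simp add: divide_inverse)

lemma summable_iterated_diff_damped_power:
  assumes "\<epsilon> \<ge> 0" "2 - real m \<le> Re s" "x \<ge> 1"
  shows "summable (\<lambda>n. norm ((\<nabla> ^^ m) (damped_power \<epsilon> s) (x + real n)))"
  using norm_iterated_diff_damped_power_le[OF assms]
  by (intro summable_comparison_test'[OF summable_diff_bound]) auto

section \<open>Continuity and holomorphy of Euler sums\<close>

text \<open>Joint continuity down to \<open>\<epsilon> = 0\<close> is what lets the identity for the absolutely
  convergent damped sums pass to the analytically continued zeta function.\<close>
lemma continuous_on_euler_sum:
  fixes f :: "'a::topological_space \<Rightarrow> real \<Rightarrow> complex"
  assumes f: "continuous_on (U \<times> {1..}) (\<lambda>(u, x). f u x)"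
    and bound: "\<And>u x n. u \<in> U \<Longrightarrow> x \<ge> 1 \<Longrightarrow> norm ((\<nabla> ^^ m) (f u) (x + real n)) \<le> M n"
    and "summable M"
  shows "continuous_on (U \<times> {1..}) (\<lambda>(u, x). euler_sum m (f u) x)"
  using f bound
proof (induction m arbitrary: f)
  case 0
  have lim: "uniform_limit (U \<times> {1..}) (\<lambda>N (u, x). \<Sum>n<N. (-1) ^ n * f u (x + real n))
      (\<lambda>(u, x). \<Sum>n. (-1) ^ n * f u (x + real n)) sequentially"
    using 0 \<open>summable M\<close> unfolding case_prod_unfold
    by (intro Weierstrass_m_test) (auto simp: norm_mult norm_power)
  have "\<forall>N. continuous_on (U \<times> {1..}) (\<lambda>(u, x). \<Sum>n<N. (-1) ^ n * f u (x + real n))"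
  proof
    have "continuous_on (U \<times> {1..}) (\<lambda>p. (\<lambda>(u, x). f u x) (fst p, snd p + real n))" for n
      by (intro continuous_on_compose2[OF 0(1)] continuous_intros) auto
    then show "continuous_on (U \<times> {1..}) (\<lambda>(u, x). \<Sum>n<N. (-1) ^ n * f u (x + real n))" for N
      by (auto simp: case_prod_unfold intro!: continuous_intros)
  qed
  from uniform_limit_theorem[OF always_eventually[OF this] lim trivial_limit_sequentially]
  show ?case unfolding euler_sum.simps .
next
  case (Suc m)
  have "continuous_on (U \<times> {1..}) (\<lambda>p. (\<lambda>(u, x). f u x) (fst p, snd p + 1))"
    by (intro continuous_on_compose2[OF Suc.prems(1)] continuous_intros) auto
  then have "continuous_on (U \<times> {1..}) (\<lambda>(u, x). \<nabla> (f u) x)"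
    using Suc.prems(1) by (auto simp: case_prod_unfold backward_diff_def intro!: continuous_intros)
  then have "continuous_on (U \<times> {1..}) (\<lambda>(u, x). euler_sum m (\<nabla> (f u)) x)"
    using Suc.prems(2) by (intro Suc.IH) (simp_all only: iterated_diff_Suc')
  with Suc.prems(1) show ?case
    by (auto simp: case_prod_unfold intro!: continuous_intros)
qed

text \<open>The factor \<open>B\<close> is bounded on closed discs by continuity, which makes the
  convergence locally uniform in \<open>s\<close>.\<close>

lemma holomorphic_on_euler_sum:
  fixes f :: "complex \<Rightarrow> real \<Rightarrow> complex"
  assumes "open S" and f: "\<And>x. x \<ge> 1 \<Longrightarrow> (\<lambda>s. f s x) holomorphic_on S"
    and bound: "\<And>s x n. s \<in> S \<Longrightarrow> x \<ge> 1 \<Longrightarrow> norm ((\<nabla> ^^ m) (f s) (x + real n)) \<le> B s * M n"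
    and B: "continuous_on S B" and "summable M" "\<And>n. M n \<ge> 0" "x \<ge> 1"
  shows "(\<lambda>s. euler_sum m (f s) x) holomorphic_on S"
  using f bound \<open>x \<ge> 1\<close>
proof (induction m arbitrary: f x)
  case 0
  show ?case unfolding euler_sum.simps
  proof (rule holomorphic_uniform_sequence[OF \<open>open S\<close>])
    show "(\<lambda>s. \<Sum>n<N. (-1) ^ n * f s (x + real n)) holomorphic_on S" for N
      using 0 by (intro holomorphic_intros) auto
    fix s assume "s \<in> S"
    with \<open>open S\<close> obtain d where d: "d > 0" "cball s d \<subseteq> S"
      by (auto simp: open_contains_cball)
    have "compact (B ` cball s d)"
      using d by (intro compact_continuous_image continuous_on_subset[OF B]) auto
    then obtain K where K: "\<And>w. w \<in> cball s d \<Longrightarrow> B w \<le> K"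
      using bounded_imp_bdd_above compact_imp_bounded
      by (metis bdd_above.unfold imageI)
    have "uniform_limit (cball s d) (\<lambda>N s. \<Sum>n<N. (-1) ^ n * f s (x + real n))
      (\<lambda>s. \<Sum>n. (-1) ^ n * f s (x + real n)) sequentially"
    proof (rule Weierstrass_m_test)
      show "summable (\<lambda>n. K * M n)" using \<open>summable M\<close> by (rule summable_mult)
      fix n w assume w: "w \<in> cball s d"
      then have "norm ((\<nabla> ^^ 0) (f w) (x + real n)) \<le> B w * M n"
        using 0 d by blast
      also have "\<dots> \<le> K * M n" using K[OF w] assms(6) by (intro mult_right_mono) auto
      finally show "norm ((-1) ^ n * f w (x + real n)) \<le> K * M n"
        by (simp add: norm_mult norm_power)
    qed
    with d show "\<exists>d>0. cball s d \<subseteq> S \<and> uniform_limit (cball s d) (\<lambda>N s. \<Sum>n<N. (-1) ^ n * f s (x + real n))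
      (\<lambda>s. \<Sum>n. (-1) ^ n * f s (x + real n)) sequentially" by blast
  qed
next
  case (Suc m)
  have "(\<lambda>s. euler_sum m (\<nabla> (f s)) x) holomorphic_on S"
  proof (rule Suc.IH)
    show "(\<lambda>s. \<nabla> (f s) x) holomorphic_on S" if "x \<ge> 1" for x
      unfolding backward_diff_def using that Suc.prems(1) by (intro holomorphic_intros) auto
  qed (use Suc.prems in \<open>simp_all only: iterated_diff_Suc'\<close>)
  with Suc.prems show ?case by (auto intro!: holomorphic_intros)
qed

section \<open>Analytic continuation of the alternating Hurwitz zeta function\<close>

text \<open>The property under the definite description in \<open>alt_hurwitz_zeta\<close>, named so
  that existence and uniqueness can be treated apart.\<close>

definition is_alt_hurwitz_zeta :: "real \<Rightarrow> (complex \<Rightarrow> complex) \<Rightarrow> bool" where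
  "is_alt_hurwitz_zeta x F \<longleftrightarrow> F holomorphic_on UNIV \<and>
     (\<forall>z. Re z > 0 \<longrightarrow> (\<lambda>n. (-1) ^ n / (of_nat n + of_real x :: complex) powr z) sums F z)"

text \<open>Uniqueness is the identity theorem: two such entire functions agree on the right
  half-plane.\<close>

lemma alt_hurwitz_zeta_eq:
  assumes "is_alt_hurwitz_zeta x F"
  shows "alt_hurwitz_zeta s x = F s"
proof -
  have "G = F" if G: "is_alt_hurwitz_zeta x G" for G
  proof
    fix z
    have sums: "(\<lambda>n. (-1) ^ n / (of_nat n + of_real x) powr z) sums F z"
        "(\<lambda>n. (-1) ^ n / (of_nat n + of_real x) powr z) sums G z" if "Re z > 0" for z
      using assms G that by (simp_all only: is_alt_hurwitz_zeta_def)
    have "(1 :: complex) \<in> {z. Re z > 0}" by simp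
    then have ne: "{z. Re z > 0} \<noteq> {}" by blast
    have holo: "F holomorphic_on UNIV" "G holomorphic_on UNIV"
      using assms G by (simp_all only: is_alt_hurwitz_zeta_def)
    show "G z = F z"
      by (rule analytic_continuation_open[OF open_halfspace_Re_gt open_UNIV ne connected_UNIV
            subset_UNIV holo(2,1) _ UNIV_I]) (rule sums_unique2[OF sums(2,1)], simp_all)
  qed
  with assms have "(THE F. is_alt_hurwitz_zeta x F) = F" by (rule the_equality)
  then show ?thesis
    by (simp add: alt_hurwitz_zeta_def is_alt_hurwitz_zeta_def)
qed

lemma euler_sum_damped_power_mono:
  assumes "\<epsilon> \<ge> 0" "2 - real m \<le> Re s" "m \<le> m'" "x \<ge> 1"
  shows "euler_sum m' (damped_power \<epsilon> s) x = euler_sum m (damped_power \<epsilon> s) x"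
  using \<open>m \<le> m'\<close>
proof (induction m' rule: dec_induct)
  case (step k)
  then have "2 - real k \<le> Re s" "2 - real (Suc k) \<le> Re s" using assms by auto
  then have "euler_sum (Suc k) (damped_power \<epsilon> s) x = euler_sum k (damped_power \<epsilon> s) x"
    using assms by (intro euler_sum_Suc summable_iterated_diff_damped_power)
  with step show ?case by simp
qed simp

text \<open>Euler's transformation performs the continuation: the further left \<open>s\<close>
  lies, the more steps are taken.\<close>

lemma is_alt_hurwitz_zeta_euler_sum:
  assumes "x \<ge> 1"
  shows "is_alt_hurwitz_zeta x (\<lambda>s. euler_sum (nat \<lceil>2 - Re s\<rceil>) (damped_power 0 s) x)"
proof -
  define F where "F s = euler_sum (nat \<lceil>2 - Re s\<rceil>) (damped_power 0 s) x" for s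
  have "F field_differentiable (at s0)" for s0
  proof -
    define S where "S = {s. Re s > Re s0 - 1}"
    \<comment> \<open>The number of steps in \<open>F\<close> jumps with \<open>Re s\<close>. On
      \<open>S\<close>, where \<open>Re s\<close> exceeds \<open>Re s0 - 1\<close>, the constant
      \<open>m\<close> is large enough for every \<open>s\<close>, so \<open>F\<close> coincides
      there with a single holomorphic Euler sum.\<close>
    define m where "m = nat \<lceil>3 - Re s0\<rceil>"
    have S: "open S" "s0 \<in> S"
      by (auto simp: S_def open_halfspace_Re_gt)
    have m: "2 - real m \<le> Re s" if "s \<in> S" for s
    proof -
      have "3 - Re s0 \<le> real m" unfolding m_def by linarith
      with that show ?thesis by (simp add: S_def)
    qed
    have "(\<lambda>s. euler_sum m (damped_power 0 s) x) holomorphic_on S"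
    proof (rule holomorphic_on_euler_sum[where B = "diff_bound m" and M = "\<lambda>n. 1 / (real (Suc n))\<^sup>2"])
      show "(\<lambda>s. damped_power 0 s x) holomorphic_on S" for x
        unfolding damped_power_def by (intro holomorphic_intros)
      show "norm ((\<nabla> ^^ m) (damped_power 0 s) (x + real n)) \<le> diff_bound m s * (1 / (real (Suc n))\<^sup>2)"
        if "s \<in> S" "x \<ge> 1" for s x n
        using that m by (intro norm_iterated_diff_damped_power_le) auto
      show "continuous_on S (diff_bound m)"
        unfolding diff_bound_def by (intro continuous_intros) auto
      show "summable (\<lambda>n. 1 / (real (Suc n))\<^sup>2)"
        using summable_diff_bound[of 1] by simp
    qed (use S assms in auto)
    moreover have "euler_sum m (damped_power 0 s) x = F s" if "s \<in> S" for s
      unfolding F_def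
    proof (rule euler_sum_damped_power_mono)
      show "nat \<lceil>2 - Re s\<rceil> \<le> m" unfolding m_def by (intro nat_mono ceiling_mono) (use that in \<open>simp add: S_def\<close>)
      show "2 - real (nat \<lceil>2 - Re s\<rceil>) \<le> Re s" by linarith
    qed (use assms in auto)
    ultimately have "F holomorphic_on S"
      by (rule holomorphic_transform)
    with S show ?thesis by (auto intro: holomorphic_on_imp_differentiable_at)
  qed
  then have "F holomorphic_on UNIV"
    by (simp add: holomorphic_on_def)
  \<comment> \<open>For \<open>Re s > 0\<close> the terms tend to 0, so the Euler sum is the sum of
    the series, also in the strip where convergence is only conditional.\<close>
  moreover have "(\<lambda>n. (-1) ^ n / (of_nat n + of_real x :: complex) powr s) sums F s" if "Re s > 0" for s
  proof -
    have "(\<lambda>n. norm (damped_power 0 s (x + real n))) = (\<lambda>n. (x + real n) powr (- Re s))"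
    proof
      show "norm (damped_power 0 s (x + real n)) = (x + real n) powr (- Re s)" for n
        using assms norm_powr_real_powr[of "of_real (x + real n)" "- s"] by (simp add: damped_power_def)
    qed
    moreover have "(\<lambda>n. (x + real n) powr (- Re s)) \<longlonglongrightarrow> 0"
      using that by real_asymp
    ultimately have "(\<lambda>n. norm (damped_power 0 s (x + real n))) \<longlonglongrightarrow> 0"
      by (simp only:)
    then have "(\<lambda>n. damped_power 0 s (x + real n)) \<longlonglongrightarrow> 0"
      by (rule tendsto_norm_zero_cancel)
    moreover have "summable (\<lambda>n. norm ((\<nabla> ^^ nat \<lceil>2 - Re s\<rceil>) (damped_power 0 s) (x + real n)))"
      using assms by (intro summable_iterated_diff_damped_power) linarith+
    ultimately have "(\<lambda>n. (-1) ^ n * damped_power 0 s (x + real n)) sums F s"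
      unfolding F_def by (rule alternating_sums_euler_sum)
    then show ?thesis
      by (simp add: damped_power_def powr_minus divide_inverse add.commute)
  qed
  ultimately show ?thesis unfolding F_def is_alt_hurwitz_zeta_def by blast
qed

text \<open>The functional equation solved for the value at \<open>x\<close>. At
  \<open>x = 0\<close> the term \<open>n = 0\<close> and the power \<open>0 powr (- s)\<close> are
  both 0 by convention.\<close>

lemma is_alt_hurwitz_zeta_backward:
  assumes "is_alt_hurwitz_zeta (x + 1) F"
  shows "is_alt_hurwitz_zeta x (\<lambda>s. of_real x powr (- s) - F s)"
  unfolding is_alt_hurwitz_zeta_def
proof (intro conjI allI impI)
  show "(\<lambda>s. of_real x powr (- s) - F s) holomorphic_on UNIV"
    using assms by (intro holomorphic_intros) (auto simp: is_alt_hurwitz_zeta_def)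
  fix s :: complex assume "Re s > 0"
  with assms have "(\<lambda>n. (-1) ^ n / (of_nat n + of_real (x + 1) :: complex) powr s) sums F s"
    by (simp add: is_alt_hurwitz_zeta_def)
  then have "(\<lambda>n. (-1) ^ Suc n / (of_nat (Suc n) + of_real x :: complex) powr s) sums (- F s)"
    using sums_minus by (simp add: add_ac)
  then have "(\<lambda>n. (-1) ^ n / (of_nat n + of_real x :: complex) powr s)
      sums (- F s + (-1) ^ 0 / (of_nat 0 + of_real x) powr s)"
    by (rule sums_Suc)
  then show "(\<lambda>n. (-1) ^ n / (of_nat n + of_real x :: complex) powr s) sums (of_real x powr (- s) - F s)"
    by (simp add: powr_minus divide_inverse)
qed

text \<open>Starting from \<open>x \<ge> 1\<close>, repeated backward unit steps reach every real
  \<open>x\<close>.\<close>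

lemma is_alt_hurwitz_zeta_exists: "\<exists>F. is_alt_hurwitz_zeta x F"
proof -
  have *: "x \<ge> 1 - real N \<Longrightarrow> \<exists>F. is_alt_hurwitz_zeta x F" for N x
  proof (induction N arbitrary: x)
    case 0
    then show ?case using is_alt_hurwitz_zeta_euler_sum by auto
  next
    case (Suc N)
    then have "x + 1 \<ge> 1 - real N" by simp
    from Suc.IH[OF this] obtain F where "is_alt_hurwitz_zeta (x + 1) F" ..
    then show ?case using is_alt_hurwitz_zeta_backward by blast
  qed
  show ?thesis by (rule *[of "nat \<lceil>1 - x\<rceil>"]) linarith
qed

text \<open>The continuation at \<open>x\<close> can be taken to be the one built from
  \<open>x + 1\<close>, so the equation holds by construction for all \<open>s\<close>.\<close>

lemma alt_hurwitz_zeta_add_1: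
  "alt_hurwitz_zeta s (x + 1) + alt_hurwitz_zeta s x = of_real x powr (- s)"
proof -
  obtain F where F: "is_alt_hurwitz_zeta (x + 1) F"
    using is_alt_hurwitz_zeta_exists by blast
  from alt_hurwitz_zeta_eq[OF F] alt_hurwitz_zeta_eq[OF is_alt_hurwitz_zeta_backward[OF F]]
  show ?thesis by simp
qed

section \<open>Damped alternating sums\<close>

text \<open>At \<open>\<epsilon> = 0\<close> the series diverges for the exponents in question,
  \<open>s = 1 - \<alpha>\<close> with \<open>\<alpha> > 1\<close>, so the continued value is put
  in; joint continuity is proved below.\<close>

definition damped_zeta :: "real \<Rightarrow> complex \<Rightarrow> real \<Rightarrow> complex" where
  "damped_zeta \<epsilon> s x = (if \<epsilon> = 0 then alt_hurwitz_zeta s x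
     else (\<Sum>n. (-1) ^ n * damped_power \<epsilon> s (x + real n)))"

text \<open>Half of the damping absorbs the power; the other half leaves exponential decay in
  \<open>x\<close> and a geometric factor in \<open>n\<close>.\<close>

lemma norm_damped_power_le:
  assumes "\<epsilon> > 0" "\<alpha> > 1"
  obtains K where "\<And>x n. x + real n \<ge> 0 \<Longrightarrow>
    norm ((-1) ^ n * damped_power \<epsilon> (of_real (1 - \<alpha>)) (x + real n))
      \<le> K * exp (- (\<epsilon> / 2) * x) * exp (- (\<epsilon> / 2)) ^ n"
proof -
  have "((\<lambda>x. x powr (\<alpha> - 1) * exp (- (\<epsilon> / 2) * x)) \<longlongrightarrow> 0) at_top"
    using assms by real_asymp
  then have "eventually (\<lambda>x. x powr (\<alpha> - 1) * exp (- (\<epsilon> / 2) * x) < 1) at_top"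
    by (rule order_tendstoD) simp
  then obtain X where X: "\<And>x. x \<ge> X \<Longrightarrow> x powr (\<alpha> - 1) * exp (- (\<epsilon> / 2) * x) < 1"
    by (auto simp: eventually_at_top_linorder)
  \<comment> \<open>Beyond \<open>X\<close> the product is below 1; on nonnegative arguments before
    \<open>X\<close> the power is at most \<open>\<bar>X\<bar> powr (\<alpha> - 1)\<close>.\<close>
  define K where "K = \<bar>X\<bar> powr (\<alpha> - 1) + 1"
  have K: "t powr (\<alpha> - 1) * exp (- (\<epsilon> / 2) * t) \<le> K" if "t \<ge> 0" for t
  proof (cases "t \<ge> X")
    case True
    then show ?thesis using X[OF True] by (simp add: K_def add_increasing)
  next
    case False
    then have "t powr (\<alpha> - 1) * exp (- (\<epsilon> / 2) * t) \<le> \<bar>X\<bar> powr (\<alpha> - 1) * 1"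
      using assms that by (intro mult_mono powr_mono2) auto
    then show ?thesis by (simp add: K_def)
  qed
  have "norm ((-1) ^ n * damped_power \<epsilon> (of_real (1 - \<alpha>)) (x + real n))
      \<le> K * exp (- (\<epsilon> / 2) * x) * exp (- (\<epsilon> / 2)) ^ n" if "x + real n \<ge> 0" for x n
  proof -
    define t where "t = x + real n"
    have "t \<ge> 0" using that by (simp add: t_def)
    then have "norm ((-1) ^ n * damped_power \<epsilon> (of_real (1 - \<alpha>)) t) = exp (- \<epsilon> * t) * t powr (\<alpha> - 1)"
      by (simp add: damped_power_def norm_mult norm_power norm_powr_real_powr)
    also have "\<dots> = t powr (\<alpha> - 1) * exp (- (\<epsilon> / 2) * t) * exp (- (\<epsilon> / 2) * t)"
      by (simp flip: exp_add)
    also have "\<dots> \<le> K * exp (- (\<epsilon> / 2) * t)"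
      using K[OF \<open>t \<ge> 0\<close>] by (intro mult_right_mono) auto
    also have "- (\<epsilon> / 2) * t = - (\<epsilon> / 2) * x + real n * (- (\<epsilon> / 2))"
      by (simp add: t_def field_simps)
    also have "K * exp \<dots> = K * exp (- (\<epsilon> / 2) * x) * exp (- (\<epsilon> / 2)) ^ n"
      by (simp only: exp_add exp_of_nat_mult mult.assoc)
    finally show ?thesis by (simp add: t_def)
  qed
  then show thesis by (rule that)
qed

lemma summable_damped_power:
  assumes "\<epsilon> > 0" "\<alpha> > 1"
  shows "summable (\<lambda>n. (-1) ^ n * damped_power \<epsilon> (of_real (1 - \<alpha>)) (x + real n))"
proof -
  obtain K where K: "\<And>x n. x + real n \<ge> 0 \<Longrightarrow>
    norm ((-1) ^ n * damped_power \<epsilon> (of_real (1 - \<alpha>)) (x + real n))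
      \<le> K * exp (- (\<epsilon> / 2) * x) * exp (- (\<epsilon> / 2)) ^ n"
    using norm_damped_power_le[OF assms] by blast
  have "summable (\<lambda>n. K * exp (- (\<epsilon> / 2) * x) * exp (- (\<epsilon> / 2)) ^ n)"
    using assms by (intro summable_mult summable_geometric) auto
  \<comment> \<open>For negative \<open>x\<close> the majorant applies only from the index at which
    \<open>x + real n\<close> becomes nonnegative.\<close>
  then show ?thesis
    by (rule summable_comparison_test'[where N = "nat \<lceil>- x\<rceil>"]) (rule K, linarith)
qed

text \<open>Summing the geometric majorant keeps the decay in \<open>x\<close>, which later excludes
  an antiperiodic remainder.\<close>

lemma norm_damped_zeta_le:
  assumes "\<epsilon> > 0" "\<alpha> > 1"
  obtains K where "\<And>x. x \<ge> 0 \<Longrightarrow> norm (damped_zeta \<epsilon> (of_real (1 - \<alpha>)) x) \<le> K * exp (- (\<epsilon> / 2) * x)"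
proof -
  obtain K where K: "\<And>x n. x + real n \<ge> 0 \<Longrightarrow>
    norm ((-1) ^ n * damped_power \<epsilon> (of_real (1 - \<alpha>)) (x + real n))
      \<le> K * exp (- (\<epsilon> / 2) * x) * exp (- (\<epsilon> / 2)) ^ n"
    using norm_damped_power_le[OF assms] by blast
  have q: "summable (\<lambda>n. exp (- (\<epsilon> / 2)) ^ n)"
    using assms by (intro summable_geometric) auto
  define L where "L = (\<Sum>n. exp (- (\<epsilon> / 2)) ^ n)"
  have "norm (damped_zeta \<epsilon> (of_real (1 - \<alpha>)) x) \<le> K * L * exp (- (\<epsilon> / 2) * x)" if "x \<ge> 0" for x
  proof -
    have "norm (\<Sum>n. (-1) ^ n * damped_power \<epsilon> (of_real (1 - \<alpha>)) (x + real n))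
        \<le> (\<Sum>n. K * exp (- (\<epsilon> / 2) * x) * exp (- (\<epsilon> / 2)) ^ n)"
      using that by (intro norm_suminf_le K summable_mult q) auto
    also have "\<dots> = K * L * exp (- (\<epsilon> / 2) * x)"
      unfolding L_def suminf_mult[OF q] by simp
    finally show ?thesis using assms by (simp add: damped_zeta_def)
  qed
  then show thesis by (rule that)
qed

lemma damped_zeta_add_1:
  assumes "\<epsilon> \<ge> 0" "\<alpha> > 1"
  shows "damped_zeta \<epsilon> (of_real (1 - \<alpha>)) (x + 1) + damped_zeta \<epsilon> (of_real (1 - \<alpha>)) x
       = damped_power \<epsilon> (of_real (1 - \<alpha>)) x"
proof (cases "\<epsilon> = 0")
  case True
  then show ?thesis by (simp add: damped_zeta_def damped_power_def alt_hurwitz_zeta_add_1)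
next
  case False
  with assms have sm: "summable (\<lambda>n. (-1) ^ n * damped_power \<epsilon> (of_real (1 - \<alpha>)) (x + real n))" for x
    by (intro summable_damped_power) auto
  have "damped_zeta \<epsilon> (of_real (1 - \<alpha>)) (x + 1)
      = - (\<Sum>n. (-1) ^ Suc n * damped_power \<epsilon> (of_real (1 - \<alpha>)) (x + real (Suc n)))"
    using suminf_minus[OF sm[of "x + 1"]] False by (simp add: damped_zeta_def add_ac)
  also have "\<dots> = - (damped_zeta \<epsilon> (of_real (1 - \<alpha>)) x - damped_power \<epsilon> (of_real (1 - \<alpha>)) x)"
    using False by (subst suminf_split_head[OF sm[of x]]) (simp add: damped_zeta_def)
  finally show ?thesis by (simp only: minus_diff_eq diff_add_cancel)
qed

text \<open>One formula with a fixed number of steps covers both cases of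
  \<open>damped_zeta\<close>, so continuity at \<open>\<epsilon> = 0\<close> can be read off from
  it. The number is \<open>2 - Re s\<close> rounded up, for \<open>s = 1 - \<alpha>\<close>.\<close>

lemma damped_zeta_eq_euler_sum:
  assumes "\<epsilon> \<ge> 0" "\<alpha> > 1" "x \<ge> 1"
  shows "damped_zeta \<epsilon> (of_real (1 - \<alpha>)) x
       = euler_sum (nat \<lceil>\<alpha> + 1\<rceil>) (damped_power \<epsilon> (of_real (1 - \<alpha>))) x"
proof (cases "\<epsilon> = 0")
  case True
  then show ?thesis
    using alt_hurwitz_zeta_eq[OF is_alt_hurwitz_zeta_euler_sum[OF \<open>x \<ge> 1\<close>]]
    by (simp add: damped_zeta_def add.commute)
next
  case False
  define s where "s = complex_of_real (1 - \<alpha>)"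
  have "(\<lambda>n. (-1) ^ n * damped_power \<epsilon> s (x + real n)) \<longlonglongrightarrow> 0"
    unfolding s_def using False assms by (intro summable_LIMSEQ_zero summable_damped_power) auto
  then have "(\<lambda>n. damped_power \<epsilon> s (x + real n)) \<longlonglongrightarrow> 0"
    by (subst (asm) tendsto_norm_zero_iff[symmetric], subst tendsto_norm_zero_iff[symmetric])
       (simp add: norm_mult norm_power)
  moreover have "summable (\<lambda>n. norm ((\<nabla> ^^ nat \<lceil>\<alpha> + 1\<rceil>) (damped_power \<epsilon> s) (x + real n)))"
  proof (rule summable_iterated_diff_damped_power)
    show "2 - real (nat \<lceil>\<alpha> + 1\<rceil>) \<le> Re s" unfolding s_def Re_complex_of_real by linarith
  qed (use assms in auto)
  ultimately have "(\<lambda>n. (-1) ^ n * damped_power \<epsilon> s (x + real n)) sums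
      euler_sum (nat \<lceil>\<alpha> + 1\<rceil>) (damped_power \<epsilon> s) x"
    by (rule alternating_sums_euler_sum)
  from sums_unique[OF this] False show ?thesis
    by (simp add: damped_zeta_def s_def)
qed

section \<open>Joint continuity in the damping parameter and the argument\<close>

text \<open>On the negative axis the principal branch is a real power times the constant phase
  \<open>exp (\<i> * pi * (\<alpha> - 1))\<close>; as \<open>\<alpha> > 1\<close>, both halves tend
  to 0 at the origin and fit together.\<close>

lemma continuous_on_damped_power:
  assumes "\<alpha> > 1"
  shows "continuous_on UNIV (\<lambda>(\<epsilon>, x). damped_power \<epsilon> (of_real (1 - \<alpha>)) x)"
proof -
  define h where "h x = (if x \<le> 0 then of_real ((- x) powr (\<alpha> - 1)) * exp (\<i> * pi * (\<alpha> - 1))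
      else complex_of_real (x powr (\<alpha> - 1)))" for x :: real
  have eq: "of_real x powr (- of_real (1 - \<alpha>)) = h x" for x :: real
    using powr_of_real_if[of x "\<alpha> - 1"] by (auto simp: h_def)
  have "continuous_on ({..0} \<union> {0..}) h"
    unfolding h_def
  proof (rule continuous_on_cases)
    show "continuous_on {..0} (\<lambda>x. of_real ((- x) powr (\<alpha> - 1)) * exp (\<i> * pi * (\<alpha> - 1)))"
      using assms by (intro continuous_on_mult continuous_on_of_real continuous_on_powr'
          continuous_on_minus continuous_on_id continuous_on_const) auto
    show "continuous_on {0..} (\<lambda>x. complex_of_real (x powr (\<alpha> - 1)))"
      using assms by (intro continuous_on_of_real continuous_on_powr'
          continuous_on_id continuous_on_const) auto
  qed auto
  moreover have "{..0} \<union> {0..} = (UNIV :: real set)" by auto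
  ultimately have "continuous_on UNIV h" by simp
  then have "continuous_on UNIV (\<lambda>p::real \<times> real. h (snd p))"
    by (rule continuous_on_compose2) (auto intro!: continuous_intros)
  then show ?thesis
    unfolding damped_power_def case_prod_unfold eq by (intro continuous_intros)
qed

text \<open>The functional equation carries continuity one unit to the left at a time.\<close>
lemma continuous_on_damped_zeta:
  assumes "\<alpha> > 1"
  shows "continuous_on ({0..} \<times> UNIV) (\<lambda>(\<epsilon>, x). damped_zeta \<epsilon> (of_real (1 - \<alpha>)) x)"
proof -
  define m where "m = nat \<lceil>\<alpha> + 1\<rceil>"
  define s where "s = complex_of_real (1 - \<alpha>)"
  have m: "2 - real m \<le> Re s" unfolding m_def s_def Re_complex_of_real by linarith
  have power: "continuous_on A (\<lambda>(\<epsilon>, x). damped_power \<epsilon> s x)" for A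
    unfolding s_def by (rule continuous_on_subset[OF continuous_on_damped_power[OF assms]]) auto
  have *: "continuous_on ({0..} \<times> {1 - real N..}) (\<lambda>(\<epsilon>, x). damped_zeta \<epsilon> s x)" for N
  proof (induction N)
    case 0
    have "continuous_on ({0..} \<times> {1..}) (\<lambda>(\<epsilon>, x). euler_sum m (damped_power \<epsilon> s) x)"
      using m by (intro continuous_on_euler_sum[OF power _ summable_diff_bound[of "diff_bound m s"]]
          norm_iterated_diff_damped_power_le) auto
    then have *: "continuous_on ({0..} \<times> {1 - real 0..}) (\<lambda>(\<epsilon>, x). euler_sum m (damped_power \<epsilon> s) x)"
      by (simp only: of_nat_0 diff_zero)
    have eq: "euler_sum m (damped_power \<epsilon> s) x = damped_zeta \<epsilon> s x" if "\<epsilon> \<ge> 0" "x \<ge> 1" for \<epsilon> x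
      unfolding s_def m_def using that assms by (intro damped_zeta_eq_euler_sum[symmetric])
    from * show ?case
    proof (rule continuous_on_eq)
      fix p :: "real \<times> real" assume "p \<in> {0..} \<times> {1 - real 0..}"
      then show "(\<lambda>(\<epsilon>, x). euler_sum m (damped_power \<epsilon> s) x) p = (\<lambda>(\<epsilon>, x). damped_zeta \<epsilon> s x) p"
        by (simp add: case_prod_unfold eq mem_Times_iff)
    qed
  next
    case (Suc N)
    have "continuous_on ({0..} \<times> {1 - real (Suc N)..})
        (\<lambda>p. (\<lambda>(\<epsilon>, x). damped_power \<epsilon> s x) p - (\<lambda>(\<epsilon>, x). damped_zeta \<epsilon> s x) (fst p, snd p + 1))"
      by (intro continuous_on_diff power continuous_on_compose2[OF Suc.IH] continuous_intros) auto
    then show ?case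
    proof (rule continuous_on_eq)
      fix p :: "real \<times> real" assume "p \<in> {0..} \<times> {1 - real (Suc N)..}"
      then show "(\<lambda>(\<epsilon>, x). damped_power \<epsilon> s x) p - (\<lambda>(\<epsilon>, x). damped_zeta \<epsilon> s x) (fst p, snd p + 1)
          = (\<lambda>(\<epsilon>, x). damped_zeta \<epsilon> s x) p"
        using damped_zeta_add_1[OF _ assms, of "fst p" "snd p"]
        by (simp add: case_prod_unfold s_def mem_Times_iff diff_eq_eq add.commute del: of_real_diff)
    qed
  qed
  have "continuous_on ({0..} \<times> UNIV) (\<lambda>(\<epsilon>, x). damped_zeta \<epsilon> s x)"
    unfolding continuous_on_eq_continuous_within
  proof
    fix p :: "real \<times> real" assume p: "p \<in> {0..} \<times> UNIV"
    obtain N :: nat where N: "1 - snd p < real N" using reals_Archimedean2 by blast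
    \<comment> \<open>The strict inequality for \<open>N\<close> leaves a neighbourhood of
      \<open>p\<close> in which both domains coincide.\<close>
    have "at p within {0..} \<times> UNIV = at p within {0..} \<times> {1 - real N..}"
      by (rule at_within_nhd[of _ "UNIV \<times> {1 - real N<..}"])
         (use N in \<open>auto simp: mem_Times_iff intro!: open_Times\<close>)
    moreover have "continuous (at p within {0..} \<times> {1 - real N..}) (\<lambda>(\<epsilon>, x). damped_zeta \<epsilon> s x)"
      using *[of N, unfolded continuous_on_eq_continuous_within]
      by (rule bspec) (use p N in \<open>auto simp: mem_Times_iff\<close>)
    ultimately show "continuous (at p within {0..} \<times> UNIV) (\<lambda>(\<epsilon>, x). damped_zeta \<epsilon> s x)"
      by (simp only:)
  qed
  then show ?thesis by (simp add: s_def)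
qed

lemma continuous_on_damped_zeta_compose:
  fixes e g :: "'a::topological_space \<Rightarrow> real"
  assumes "\<alpha> > 1" "continuous_on S e" "continuous_on S g" "\<And>p. p \<in> S \<Longrightarrow> e p \<ge> 0"
  shows "continuous_on S (\<lambda>p. damped_zeta (e p) (of_real (1 - \<alpha>)) (g p))"
proof -
  have "continuous_on S (\<lambda>p. (\<lambda>(\<epsilon>, x). damped_zeta \<epsilon> (of_real (1 - \<alpha>)) x) (e p, g p))"
    by (rule continuous_on_compose2[OF continuous_on_damped_zeta[OF assms(1)] continuous_on_Pair[OF assms(2,3)]])
       (use assms(4) in auto)
  then show ?thesis by (simp only: prod.case)
qed

section \<open>The convolution identity, damped and in the limit\<close>

text \<open>The exponentials multiply to the constant \<open>exp (- \<epsilon> * x)\<close>, and the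
  substitution \<open>t = x * u\<close> leaves Euler's Beta integral, for either sign of
  \<open>x\<close>.\<close>

lemma interval_integral_damped_power_mult:
  fixes \<alpha> \<beta> \<epsilon> x :: real
  assumes "\<alpha> > 1" "\<beta> > 1"
  shows "(LBINT t=ereal 0..ereal x. damped_power \<epsilon> (of_real (1 - \<alpha>)) t * damped_power \<epsilon> (of_real (1 - \<beta>)) (x - t))
       = of_real (Beta \<alpha> \<beta>) * damped_power \<epsilon> (of_real (1 - \<alpha> - \<beta>)) x"
proof (cases "x = 0")
  case True
  then show ?thesis by (simp add: damped_power_def flip: zero_ereal_def)
next
  case False
  define f where "f t = damped_power \<epsilon> (of_real (1 - \<alpha>)) t * damped_power \<epsilon> (of_real (1 - \<beta>)) (x - t)" for t
  define b where "b u = u powr (\<alpha> - 1) * (1 - u) powr (\<beta> - 1)" for u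
  have power: "continuous_on UNIV (\<lambda>t. damped_power \<epsilon> (of_real (1 - \<gamma>)) (g t))"
    if "\<gamma> > 1" "continuous_on UNIV g" for \<gamma> g
  proof -
    have "continuous_on UNIV (\<lambda>t. (\<lambda>(\<epsilon>, x). damped_power \<epsilon> (of_real (1 - \<gamma>)) x) (\<epsilon>, g t))"
      by (rule continuous_on_compose2[OF continuous_on_damped_power[OF that(1)]
            continuous_on_Pair[OF continuous_on_const that(2)]]) auto
    then show ?thesis by (simp only: prod.case)
  qed
  have f: "continuous_on UNIV f"
    unfolding f_def using assms by (intro continuous_intros power) auto
  \<comment> \<open>The factors \<open>u\<close> and \<open>1 - u\<close> are nonnegative reals, so
    they can be pulled out of a principal-branch power even when \<open>x\<close> is
    negative.\<close>
  have f_scaled: "of_real x * f (x * u) = of_real (b u) * damped_power \<epsilon> (of_real (1 - \<alpha> - \<beta>)) x"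
    if u: "u \<in> {0..1}" for u
  proof -
    have "f (x * u) = of_real (exp (- \<epsilon> * x)) * (of_real (x * u) powr of_real (\<alpha> - 1) * of_real (x - x * u) powr of_real (\<beta> - 1))"
      by (simp add: f_def damped_power_def algebra_simps flip: exp_add of_real_mult)
    also have "complex_of_real (x * u) powr of_real (\<alpha> - 1) = of_real (u powr (\<alpha> - 1)) * of_real x powr of_real (\<alpha> - 1)"
      using u powr_times_real_left[of "of_real u" "of_real x" "of_real (\<alpha> - 1)"]
      by (simp only: powr_of_real atLeastAtMost_iff of_real_mult mult.commute) simp
    also have "complex_of_real (x - x * u) powr of_real (\<beta> - 1) = of_real ((1 - u) powr (\<beta> - 1)) * of_real x powr of_real (\<beta> - 1)"
    proof -
      have "complex_of_real (x - x * u) = of_real (1 - u) * of_real x" by (simp add: algebra_simps)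
      then show ?thesis
        using u powr_times_real_left[of "of_real (1 - u)" "of_real x" "of_real (\<beta> - 1)"]
        by (simp add: powr_of_real del: of_real_diff)
    qed
    \<comment> \<open>The Jacobian \<open>of_real x\<close> is written as a power with exponent 1,
      valid as \<open>x\<close> is nonzero; the three exponents then add up to
      \<open>\<alpha> + \<beta> - 1\<close>.\<close>
    finally have "of_real x * f (x * u) = of_real (b u) * (of_real (exp (- \<epsilon> * x)) *
        (of_real x powr 1 * of_real x powr of_real (\<alpha> - 1) * of_real x powr of_real (\<beta> - 1)))"
      using False by (simp add: b_def mult_ac)
    also have "of_real x powr 1 * of_real x powr of_real (\<alpha> - 1) * of_real x powr of_real (\<beta> - 1)
        = complex_of_real x powr (- of_real (1 - \<alpha> - \<beta>))"
      by (simp only: powr_add[symmetric]) (simp add: algebra_simps)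
    finally show ?thesis by (simp add: damped_power_def)
  qed
  have b: "continuous_on {0..1} b"
    unfolding b_def using assms by (intro continuous_intros continuous_on_powr') auto
  have "(LBINT t=ereal 0..ereal x. f t) = of_real x * (LBINT u=ereal 0..ereal 1. f (x * u))"
    using interval_integral_affine[OF f, where c = x and a = 0 and b = 1 and d = 0] by simp
  also have "\<dots> = (LBINT u=ereal 0..ereal 1. of_real x * f (x * u))"
    by simp
  also have "\<dots> = (LBINT u=ereal 0..ereal 1. of_real (b u) * damped_power \<epsilon> (of_real (1 - \<alpha> - \<beta>)) x)"
    by (intro interval_integral_cong f_scaled) (auto simp: einterval_iff)
  also have "\<dots> = (LBINT u=ereal 0..ereal 1. complex_of_real (b u)) * damped_power \<epsilon> (of_real (1 - \<alpha> - \<beta>)) x"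
    by simp
  also have "(LBINT u=ereal 0..ereal 1. complex_of_real (b u)) = integral {0..1} (\<lambda>u. of_real (b u))"
    using b by (intro interval_integral_eq_integral_continuous continuous_intros) auto
  also have "\<dots> = of_real (Beta \<alpha> \<beta>)"
    using has_integral_Beta_real[of \<alpha> \<beta>] assms unfolding b_def[symmetric]
    by (intro integral_unique has_integral_of_real) auto
  finally show ?thesis by (simp add: f_def)
qed

lemma continuous_on_damped_zeta_section:
  assumes "\<alpha> > 1" "\<epsilon> \<ge> 0"
  shows "continuous_on UNIV (damped_zeta \<epsilon> (of_real (1 - \<alpha>)))"
  using assms
  by (intro continuous_on_damped_zeta_compose[where e = "\<lambda>_. \<epsilon>" and g = "\<lambda>x. x"]) auto

text \<open>Both sides satisfy the same functional equation, so their difference is antiperiodic;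
  for \<open>\<epsilon> > 0\<close> both sides decay, which forces it to be 0.\<close>

lemma antiperiodic_conv_damped_zeta:
  assumes "\<alpha> > 1" "\<beta> > 1" "\<epsilon> > 0"
  shows "antiperiodic_conv (damped_zeta \<epsilon> (of_real (1 - \<alpha>))) (damped_zeta \<epsilon> (of_real (1 - \<beta>))) x
       = of_real (Beta \<alpha> \<beta>) * damped_zeta \<epsilon> (of_real (1 - \<alpha> - \<beta>)) x"
proof -
  define C where "C = antiperiodic_conv (damped_zeta \<epsilon> (of_real (1 - \<alpha>))) (damped_zeta \<epsilon> (of_real (1 - \<beta>)))"
  \<comment> \<open>The grouping \<open>1 - (\<alpha> + \<beta>)\<close> makes the lemmas on a
    single exponent above 1 applicable to the sum.\<close>
  define Z where "Z = damped_zeta \<epsilon> (of_real (1 - (\<alpha> + \<beta>)))"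
  have "C (x + 1) + C x = of_real (Beta \<alpha> \<beta>) * damped_power \<epsilon> (of_real (1 - \<alpha> - \<beta>)) x" for x
    unfolding C_def using assms
    by (subst antiperiodic_conv_add[OF continuous_on_damped_zeta_section damped_zeta_add_1
          continuous_on_damped_zeta_section damped_zeta_add_1])
       (auto simp: interval_integral_damped_power_mult simp del: of_real_diff)
  moreover have "Z (x + 1) + Z x = damped_power \<epsilon> (of_real (1 - (\<alpha> + \<beta>))) x" for x
    unfolding Z_def using assms by (intro damped_zeta_add_1) auto
  ultimately have sum: "C (x + 1) + C x = of_real (Beta \<alpha> \<beta>) * (Z (x + 1) + Z x)" for x
    by (simp only: diff_diff_eq)
  have anti: "C (x + 1) - of_real (Beta \<alpha> \<beta>) * Z (x + 1) = - (C x - of_real (Beta \<alpha> \<beta>) * Z x)" for x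
    using sum[of x] by algebra
  obtain K where K: "\<And>x. x \<ge> 0 \<Longrightarrow> norm (damped_zeta \<epsilon> (of_real (1 - \<alpha>)) x) \<le> K * exp (- (\<epsilon> / 2) * x)"
    using norm_damped_zeta_le[OF assms(3,1)] by blast
  obtain L where L: "\<And>x. x \<ge> 0 \<Longrightarrow> norm (damped_zeta \<epsilon> (of_real (1 - \<beta>)) x) \<le> L * exp (- (\<epsilon> / 2) * x)"
    using norm_damped_zeta_le[OF assms(3,2)] by blast
  obtain M where M: "\<And>x. x \<ge> 0 \<Longrightarrow> norm (Z x) \<le> M * exp (- (\<epsilon> / 2) * x)"
    using norm_damped_zeta_le[OF assms(3), of "\<alpha> + \<beta>"] assms unfolding Z_def by auto
  have "(C \<longlongrightarrow> 0) at_top"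
    unfolding C_def using assms K L
    by (intro antiperiodic_conv_tendsto_0[where c = "\<epsilon> / 2"] continuous_on_damped_zeta_section) auto
  moreover have "(Z \<longlongrightarrow> 0) at_top"
  proof (rule Lim_null_comparison)
    show "\<forall>\<^sub>F x in at_top. norm (Z x) \<le> M * exp (- (\<epsilon> / 2) * x)"
      using eventually_ge_at_top[of 0] by eventually_elim (rule M)
    show "((\<lambda>x. M * exp (- (\<epsilon> / 2) * x)) \<longlongrightarrow> 0) at_top"
      using assms by real_asymp
  qed
  ultimately have "((\<lambda>x. C x - of_real (Beta \<alpha> \<beta>) * Z x) \<longlongrightarrow> 0 - of_real (Beta \<alpha> \<beta>) * 0) at_top"
    by (intro tendsto_intros)
  then have "C x - of_real (Beta \<alpha> \<beta>) * Z x = 0"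
    by (intro antiperiodic_tendsto_0_imp_0[of "\<lambda>x. C x - of_real (Beta \<alpha> \<beta>) * Z x"] anti) simp
  then show ?thesis by (simp add: C_def Z_def diff_diff_eq)
qed

text \<open>The difference of the damped sides is continuous in \<open>\<epsilon> \<ge> 0\<close>
  and vanishes for \<open>\<epsilon> > 0\<close>, hence also at 0, where \<open>damped_zeta\<close>
  is the continued zeta function.\<close>

lemma antiperiodic_conv_alt_hurwitz_zeta:
  assumes "\<alpha> > 1" "\<beta> > 1"
  shows "antiperiodic_conv (alt_hurwitz_zeta (of_real (1 - \<alpha>))) (alt_hurwitz_zeta (of_real (1 - \<beta>))) x
       = of_real (Beta \<alpha> \<beta>) * alt_hurwitz_zeta (of_real (1 - \<alpha> - \<beta>)) x"
proof -
  define D where "D \<epsilon> = antiperiodic_conv (damped_zeta \<epsilon> (of_real (1 - \<alpha>))) (damped_zeta \<epsilon> (of_real (1 - \<beta>))) x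
    - of_real (Beta \<alpha> \<beta>) * damped_zeta \<epsilon> (of_real (1 - (\<alpha> + \<beta>))) x" for \<epsilon>
  have "continuous_on {0..} (\<lambda>\<epsilon>. damped_zeta \<epsilon> (of_real (1 - (\<alpha> + \<beta>))) x)"
    using assms by (intro continuous_on_damped_zeta_compose continuous_intros) auto
  moreover have "continuous_on ({0..} \<times> UNIV)
      (\<lambda>(\<epsilon>, t). damped_zeta \<epsilon> (of_real (1 - \<alpha>)) t * damped_zeta \<epsilon> (of_real (1 - \<beta>)) (c - t))" for c
    unfolding case_prod_unfold using assms
    by (intro continuous_on_mult continuous_on_damped_zeta_compose continuous_intros) auto
  ultimately have "continuous_on {0..} D"
    unfolding D_def antiperiodic_conv_def
    by (intro continuous_on_diff continuous_on_mult continuous_on_const continuous_on_interval_integral_param)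
  moreover have "D \<epsilon> = 0" if "\<epsilon> \<in> {0<..}" for \<epsilon>
    using antiperiodic_conv_damped_zeta[OF assms, of \<epsilon> x] that by (simp add: D_def diff_diff_eq)
  moreover have "(0::real) \<in> closure {0<..}" by simp
  ultimately have "D 0 = 0"
    using continuous_constant_on_closure[of "{0<..}" D 0 0] by simp
  then show ?thesis by (simp add: D_def damped_zeta_def[abs_def] diff_diff_eq)
qed

theorem theorem1p6:
  fixes \<alpha> \<beta> x y :: real
  assumes "\<alpha> > 1" and "\<beta> > 1" and "y > 0"
  shows "alt_conv
           (\<lambda>x y. of_real (y powr (\<alpha> - 1)) * alt_hurwitz_zeta (of_real (1 - \<alpha>)) (x / y)
                   / of_real (Gamma \<alpha>))
           (\<lambda>x y. of_real (y powr (\<beta> - 1)) * alt_hurwitz_zeta (of_real (1 - \<beta>)) (x / y)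
                   / of_real (Gamma \<beta>)) x y
         = of_real (y powr (\<alpha> + \<beta> - 1)) * alt_hurwitz_zeta (of_real (1 - \<alpha> - \<beta>)) (x / y)
             / of_real (Gamma (\<alpha> + \<beta>))"
proof -
  define a where "a = alt_hurwitz_zeta (of_real (1 - \<alpha>))"
  define b where "b = alt_hurwitz_zeta (of_real (1 - \<beta>))"
  define A :: complex where "A = of_real (y powr (\<alpha> - 1)) / of_real (Gamma \<alpha>)"
  define B :: complex where "B = of_real (y powr (\<beta> - 1)) / of_real (Gamma \<beta>)"
  have a: "continuous_on UNIV a" and b: "continuous_on UNIV b"
    using continuous_on_damped_zeta_section[of _ 0] assms
    by (simp_all add: a_def b_def damped_zeta_def[abs_def] del: of_real_diff)
  \<comment> \<open>Reduction to \<open>y = 1\<close>: the substitution by \<open>t / y\<close>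
    contributes the factor \<open>y\<close>, and the normalising constants come out.\<close>
  have scale: "(LBINT t=ereal p..ereal q. A * a (t / y) * (B * b ((r - t) / y)))
      = A * B * y * (LBINT t=ereal (p / y)..ereal (q / y). a t * b (r / y - t))" for p q r
  proof -
    have "continuous_on UNIV (\<lambda>t. a (t / y) * b ((r - t) / y))"
      using \<open>y > 0\<close> by (intro continuous_intros continuous_on_compose2[OF a] continuous_on_compose2[OF b]) auto
    from interval_integral_affine[OF this, where c = y and d = 0 and a = "p / y" and b = "q / y"]
    have "(LBINT t=ereal p..ereal q. a (t / y) * b ((r - t) / y))
        = y * (LBINT t=ereal (p / y)..ereal (q / y). a t * b (r / y - t))"
      using \<open>y > 0\<close> by (simp add: diff_divide_distrib)
    moreover have "(\<lambda>t. A * a (t / y) * (B * b ((r - t) / y))) = (\<lambda>t. A * B * (a (t / y) * b ((r - t) / y)))"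
      by (simp add: mult_ac)
    ultimately show ?thesis by simp
  qed
  have "alt_conv (\<lambda>x y. of_real (y powr (\<alpha> - 1)) * alt_hurwitz_zeta (of_real (1 - \<alpha>)) (x / y)
                   / of_real (Gamma \<alpha>))
           (\<lambda>x y. of_real (y powr (\<beta> - 1)) * alt_hurwitz_zeta (of_real (1 - \<beta>)) (x / y)
                   / of_real (Gamma \<beta>)) x y
      = (LBINT t=ereal 0..ereal x. A * a (t / y) * (B * b ((x - t) / y)))
      - (LBINT t=ereal x..ereal y. A * a (t / y) * (B * b ((x + y - t) / y)))"
    by (simp add: alt_conv_def A_def B_def a_def b_def)
  \<comment> \<open>Division by \<open>y\<close> turns the endpoint \<open>y\<close> into 1 and
    \<open>x + y\<close> into \<open>x / y + 1\<close>.\<close>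
  also have "\<dots> = A * B * y * antiperiodic_conv a b (x / y)"
    unfolding scale antiperiodic_conv_def using \<open>y > 0\<close> by (simp add: add_divide_distrib algebra_simps)
  also have "\<dots> = A * B * y * of_real (Beta \<alpha> \<beta>) * alt_hurwitz_zeta (of_real (1 - \<alpha> - \<beta>)) (x / y)"
    unfolding a_def b_def antiperiodic_conv_alt_hurwitz_zeta[OF assms(1,2)] by simp
  \<comment> \<open>The Gamma factors in the numerator of the Beta function cancel those in
    \<open>A\<close> and \<open>B\<close>; the factor \<open>y\<close> supplies the missing unit in
    the exponent.\<close>
  also have "A * B * y * of_real (Beta \<alpha> \<beta>) = of_real (y powr (\<alpha> + \<beta> - 1)) / of_real (Gamma (\<alpha> + \<beta>))"
  proof -
    have "Gamma \<alpha> > 0" "Gamma \<beta> > 0" using assms by (simp_all add: Gamma_real_pos)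
    moreover have "y powr (\<alpha> - 1) * y powr (\<beta> - 1) * y = y powr (\<alpha> + \<beta> - 1)"
      using \<open>y > 0\<close> by (simp add: powr_diff powr_add)
    ultimately have "y powr (\<alpha> - 1) / Gamma \<alpha> * (y powr (\<beta> - 1) / Gamma \<beta>) * y * Beta \<alpha> \<beta>
        = y powr (\<alpha> + \<beta> - 1) / Gamma (\<alpha> + \<beta>)"
      by (simp add: Beta_def field_simps)
    then show ?thesis
      unfolding A_def B_def by (simp flip: of_real_mult of_real_divide)
  qed
  finally show ?thesis by (simp only: times_divide_eq_left)
qed

end
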